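(* Let $(X,\|\cdot\|)$ be a Banach space. Then the class $\mathcal{C}_{K}(X)$ of all Kannan mappings $T:X\to X$ is an unsaturated class of mappings, i.e. the inclusion $\mathcal{C}_{K}(X)\subset \mathcal{C}_{K}^{e}(X)$ is strict.
   Context: For a self mapping $T:X\to X$ of a linear normed space $(X,\|\cdot\|)$ and $\lambda\in(0,1]$, the averaged mapping $T_\lambda:X\to X$ is $T_\lambda x=(1-\lambda)x+\lambda Tx$. If $\mathcal{C}$ is a subset of the family of all self mappings of $X$, a mapping $T:X\to X$ is called $\mathcal{C}$-enriched if there exists $\lambda\in(0,1]$ such that $T_\lambda\in\mathcal{C}$; $\mathcal{C}^{e}$ denotes the set of all $\mathcal{C}$-enriched mappings. One always has $\mathcal{C}\subseteq\mathcal{C}^{e}$ (take $\lambda=1$). The class $\mathcal{C}$ is called unsaturated if the inclusion $\mathcal{C}\subset\mathcal{C}^{e}$ is strict, and saturated if $\mathcal{C}=\mathcal{C}^{e}$. A mapping $T:X\to X$ is a Kannan mapping (Kannan contraction) if there exists a constant $a\in[0,1/2)$ such that $\|Tx-Ty\|\le a\left(\|x-Tx\|+\|y-Ty\|\right)$ for all $x,y\in X$. $\mathcal{C}_{K}(X)$ denotes the class of all Kannan mappings on $X$, and $\mathcal{C}_{K}^{e}(X)=(\mathcal{C}_{K}(X))^{e}$.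
   Formalization: The Banach space X is assumed to be different from {0}; for X = {0} the only self mapping is the zero map, which is Kannan, so the inclusion is an equality and the claim fails. *)

theory Defs
  imports "HOL-Analysis.Analysis"
begin

definition averaged_map ::
    "real \<Rightarrow> ('a::real_normed_vector \<Rightarrow> 'a) \<Rightarrow> 'a \<Rightarrow> 'a" where
  "averaged_map l T x = (1 - l) *\<^sub>R x + l *\<^sub>R T x"

definition enriched_class ::
    "('a::real_normed_vector \<Rightarrow> 'a) set \<Rightarrow> ('a \<Rightarrow> 'a) set" where
  "enriched_class C = {T. \<exists>l\<in>{0<..1}. averaged_map l T \<in> C}"

definition unsaturated :: "('a::real_normed_vector \<Rightarrow> 'a) set \<Rightarrow> bool" where
  "unsaturated C \<longleftrightarrow> C \<subset> enriched_class C"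

definition Kannan_mapping :: "('a::real_normed_vector \<Rightarrow> 'a) \<Rightarrow> bool" where
  "Kannan_mapping T \<longleftrightarrow>
    (\<exists>a\<in>{0..<1/2}. \<forall>x y. norm (T x - T y) \<le> a * (norm (x - T x) + norm (y - T y)))"

definition Kannan_class :: "('a::real_normed_vector \<Rightarrow> 'a) set" where
  "Kannan_class = {T. Kannan_mapping T}"

end

theory Submission
  imports Defs
begin

text \<open>The map \<open>uminus\<close> witnesses strictness. Its average with the identity is the
  zero map, which is Kannan, so \<open>uminus\<close> is enriched Kannan. It is not Kannan itself:
  on a pair x, -x with x nonzero it would force a constant of at least 1/2.\<close>

lemma subset_enriched_class: "C \<subseteq> enriched_class C"
proof
  fix T assume "T \<in> C"
  moreover have "averaged_map 1 T = T"
    by (simp add: fun_eq_iff averaged_map_def)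
  ultimately show "T \<in> enriched_class C"
    unfolding enriched_class_def by (auto intro!: bexI[of _ 1])
qed

lemma uminus_in_enriched_Kannan_class:
  "(uminus :: 'a::real_normed_vector \<Rightarrow> 'a) \<in> enriched_class Kannan_class"
proof -
  \<comment> \<open>For \<open>uminus\<close> the average with weight l is (1 - 2 l) times the
    identity, which vanishes at l = 1/2.\<close>
  have "averaged_map (1/2) (uminus :: 'a \<Rightarrow> 'a) = (\<lambda>_. 0)"
    by (simp add: fun_eq_iff averaged_map_def)
  moreover have "Kannan_mapping (\<lambda>_. 0 :: 'a)"
    unfolding Kannan_mapping_def by (auto intro!: bexI[of _ 0])
  ultimately show ?thesis
    unfolding enriched_class_def Kannan_class_def by (auto intro!: bexI[of _ "1/2"])
qed

lemma not_Kannan_mapping_uminus: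
  fixes x :: "'a::real_normed_vector"
  assumes "x \<noteq> 0"
  shows "\<not> Kannan_mapping (uminus :: 'a \<Rightarrow> 'a)"
proof
  assume "Kannan_mapping (uminus :: 'a \<Rightarrow> 'a)"
  then obtain a where a: "a < 1/2"
    and K: "\<And>u v :: 'a. norm (- u - - v) \<le> a * (norm (u - - u) + norm (v - - v))"
    unfolding Kannan_mapping_def by auto
  have double: "norm (u + u) = 2 * norm u" for u :: 'a
    by (simp flip: scaleR_2)
  have "norm (- x - x) = 2 * norm x"
    using double[of "- x"] by simp
  \<comment> \<open>Each of x and -x is moved by 2 \<open>norm x\<close>, which is also the distance
    between their images. Hence 2 \<le> 4 a, against a < 1/2.\<close>
  then have "2 * norm x \<le> (4 * a) * norm x"
    using K[of x "- x"] double[of x] by simp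
  with a assms show False
    by simp
qed

text \<open>A nonzero vector is required because the zero space has a single self-map, which is
  Kannan, so there the inclusion is an equality.\<close>

theorem proposition5:
  assumes nontrivial: "\<exists>x::'a::banach. x \<noteq> 0"
  shows "unsaturated (Kannan_class :: ('a \<Rightarrow> 'a) set)"
  using nontrivial subset_enriched_class[of "Kannan_class :: ('a \<Rightarrow> 'a) set"]
    uminus_in_enriched_Kannan_class not_Kannan_mapping_uminus
  unfolding unsaturated_def Kannan_class_def by blast

end
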